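(* Let $n>2$, let $\Phi:[0,1]_{\mathbb D}\to\mathbb D^{+}$ be an admissible hyperbolic generator, and let $\mathcal N_\Phi:\mathcal P_{\mathbb D}(n)\to\mathcal P_{\mathbb D}(n)$ be the hyperbolic negator generated by $\Phi$. Suppose that, for every $P=(p_1,\ldots,p_n)\in\mathcal P_{\mathbb D}(n)$, every active idempotent component $\ell\in\{1,2\}$ of $P$, and all $i,j\in\{1,\ldots,n\}$, \[ p_j^{(\ell)}=1\ \Longrightarrow\ \Phi^{(\ell)}(p_j)=0, \] and \[ p_i^{(\ell)}\le p_j^{(\ell)}<1\ \Longrightarrow\ \Phi^{(\ell)}(p_i)\ge\Phi^{(\ell)}(p_j)\ \text{ and }\ \frac{\Phi^{(\ell)}(p_i)}{1-p_i^{(\ell)}}\le\frac{\Phi^{(\ell)}(p_j)}{1-p_j^{(\ell)}}. \] For $P\in\mathcal P_{\mathbb D}(n)$, let $P_m=\mathcal N_\Phi^m(P)=(p_{m,1},\ldots,p_{m,n})$ be the $m$-th iterate. Then, for every $m\ge 0$, \[ \mathcal Q(P_m)\preceq_{\mathbb D}\frac{1}{(n-1)^{2m}}\mathcal Q(P). \] In particular, for every $j=1,\ldots,n$ and every $\ell\in\{1,2\}$, \[ \left(p_{m,j}^{(\ell)}-\frac{s^{(\ell)}(P)}{n}\right)^2\le\frac{1}{(n-1)^{2m}}\mathcal Q^{(\ell)}(P). \] Moreover, \[ d_{\mathbb D}\left(P_m,U_n^{s(P)}\right)^2\le\frac{1}{(n-1)^{2m}}\sqrt{\mathcal Q^{(1)}(P)\,\mathcal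 Q^{(2)}(P)}. \]
   Context: Hyperbolic numbers: $\mathbb D=\{a+\mathbf k b: a,b\in\mathbb R\}$ with $\mathbf k^2=1$, $\mathbf e_1=(1+\mathbf k)/2$, $\mathbf e_2=(1-\mathbf k)/2$. Every $z\in\mathbb D$ is uniquely $z=z^{(1)}\mathbf e_1+z^{(2)}\mathbf e_2$ with $z^{(1)},z^{(2)}\in\mathbb R$; addition and multiplication are component-wise in these coordinates, and $1=\mathbf e_1+\mathbf e_2$. Partial order: $z\preceq_{\mathbb D}w$ iff $z^{(1)}\le w^{(1)}$ and $z^{(2)}\le w^{(2)}$. $\mathbb D^{+}=\{z: 0\preceq_{\mathbb D}z\}$ and $[0,1]_{\mathbb D}=\{z: 0\preceq_{\mathbb D}z\preceq_{\mathbb D}1\}$. Distributions: $\mathcal P_{\mathbb D}(n)$ is the set of $P=(p_1,\ldots,p_n)\in\mathbb D^n$ with all $p_j\in[0,1]_{\mathbb D}$ and $s(P):=\sum_j p_j\in\{1,\mathbf e_1,\mathbf e_2\}$. Write $p_j=p_j^{(1)}\mathbf e_1+p_j^{(2)}\mathbf e_2$, $s^{(\ell)}(P)=\sum_j p_j^{(\ell)}\in\{0,1\}$. Component $\ell$ of $P$ is active if $s^{(\ell)}(P)=1$ and inactive if $s^{(\ell)}(P)=0$. For $s\in\{1,\mathbf e_1,\mathbf e_2\}$, $U_n^s=(s/n,\ldots,s/n)$. Hyperbolic separation: for $P,Q\in\mathbb D^n$, $d_{\mathbb D}(P,Q)=\left(\sum_{j=1}^n\left|(p_j^{(1)}-q_j^{(1)})(p_j^{(2)}-q_j^{(2)})\right|\right)^{1/2}$.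 Quadratic deviation: $\mathcal Q(P)=\mathcal Q^{(1)}(P)\mathbf e_1+\mathcal Q^{(2)}(P)\mathbf e_2$ with $\mathcal Q^{(\ell)}(P)=\sum_{j=1}^n\left(p_j^{(\ell)}-\frac{s^{(\ell)}(P)}{n}\right)^2$. Generators: a map $\Phi=\Phi^{(1)}\mathbf e_1+\Phi^{(2)}\mathbf e_2:[0,1]_{\mathbb D}\to\mathbb D^{+}$ is an admissible hyperbolic generator (for the given $n$) if (i) $z\preceq_{\mathbb D}w$ implies $\Phi(w)\preceq_{\mathbb D}\Phi(z)$, and (ii) for every $P\in\mathcal P_{\mathbb D}(n)$ and every active component $\ell$ of $P$, $Z_\ell^\Phi(P):=\sum_{j=1}^n\Phi^{(\ell)}(p_j)>0$. The generated negator is $\mathcal N_\Phi(P)=(q_1,\ldots,q_n)$ with $q_j^{(\ell)}=\Phi^{(\ell)}(p_j)/Z_\ell^\Phi(P)$ if component $\ell$ of $P$ is active, and $q_j^{(\ell)}=0$ if it is inactive. *)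

theory Defs
  imports "HOL-Analysis.Finite_Cartesian_Product"
begin

section \<open>Hyperbolic numbers\<close>

text \<open>\<open>Hyp a b\<close> stands for \<open>a + \<^bold>k b\<close> with \<open>\<^bold>k\<^sup>2 = 1\<close>.\<close>

datatype hyp = Hyp (hreal: real) (hunip: real)

lemma hyp_eq_iff: "z = w \<longleftrightarrow> hreal z = hreal w \<and> hunip z = hunip w"
  by (cases z; cases w) auto

instantiation hyp :: "{comm_ring_1, real_algebra_1}"
begin

definition "0 = Hyp 0 0"
definition "1 = Hyp 1 0"
definition "z + w = Hyp (hreal z + hreal w) (hunip z + hunip w)"
definition "- z = Hyp (- hreal z) (- hunip z)"
definition "z - w = Hyp (hreal z - hreal w) (hunip z - hunip w)"
definition "z * w = Hyp (hreal z * hreal w + hunip z * hunip w) (hreal z * hunip w + hunip z * hreal w)"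
definition "c *\<^sub>R z = Hyp (c * hreal z) (c * hunip z)"

instance
  by standard
    (auto simp: zero_hyp_def one_hyp_def plus_hyp_def uminus_hyp_def minus_hyp_def
      times_hyp_def scaleR_hyp_def algebra_simps hyp_eq_iff)

end

definition hyp_k :: hyp where "hyp_k = Hyp 0 1"

definition hyp_e1 :: hyp where "hyp_e1 = (1/2) *\<^sub>R (1 + hyp_k)"

definition hyp_e2 :: hyp where "hyp_e2 = (1/2) *\<^sub>R (1 - hyp_k)"

text \<open>The idempotent components \<open>z\<^sup>(\<^sup>1\<^sup>)\<close> and \<open>z\<^sup>(\<^sup>2\<^sup>)\<close>; only \<open>l \<in> {1, 2}\<close> is meaningful.
  That they are the coordinates with respect to \<open>\<^bold>e\<^sub>1, \<^bold>e\<^sub>2\<close> is \<open>hyp_decomp\<close> and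
  \<open>hcomp_unique\<close> below.\<close>

definition hcomp :: "nat \<Rightarrow> hyp \<Rightarrow> real" where
  "hcomp l z = (if l = 1 then hreal z + hunip z else hreal z - hunip z)"

lemmas hyp_defs = zero_hyp_def one_hyp_def plus_hyp_def uminus_hyp_def minus_hyp_def
  times_hyp_def scaleR_hyp_def hyp_k_def hyp_e1_def hyp_e2_def hcomp_def

lemma hyp_k_square: "hyp_k * hyp_k = 1"
  by (simp add: hyp_defs)

lemma hyp_decomp: "z = hcomp 1 z *\<^sub>R hyp_e1 + hcomp 2 z *\<^sub>R hyp_e2"
  by (simp add: hyp_defs hyp_eq_iff field_simps)

lemma hcomp_unique:
  assumes "z = x *\<^sub>R hyp_e1 + y *\<^sub>R hyp_e2"
  shows "hcomp 1 z = x" "hcomp 2 z = y"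
  unfolding assms by (simp_all add: hyp_defs field_simps)

lemma hcomp_combine [simp]:
  "hcomp (Suc 0) (x *\<^sub>R hyp_e1 + y *\<^sub>R hyp_e2) = x"
  "hcomp 2 (x *\<^sub>R hyp_e1 + y *\<^sub>R hyp_e2) = y"
  using hcomp_unique[OF refl, of x y] by simp_all

lemma hcomp_simps [simp]:
  "hcomp l 0 = 0" "hcomp l 1 = 1" "hcomp l (z + w) = hcomp l z + hcomp l w"
  "hcomp l (- z) = - hcomp l z" "hcomp l (z - w) = hcomp l z - hcomp l w"
  "hcomp l (z * w) = hcomp l z * hcomp l w" "hcomp l (c *\<^sub>R z) = c * hcomp l z"
  "hcomp (Suc 0) hyp_e1 = 1" "hcomp 2 hyp_e1 = 0" "hcomp (Suc 0) hyp_e2 = 0" "hcomp 2 hyp_e2 = 1"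
  by (simp_all add: hyp_defs algebra_simps)

lemma hcomp_sum: "hcomp l (sum f A) = (\<Sum>x\<in>A. hcomp l (f x))"
  by (induction A rule: infinite_finite_induct) simp_all

lemma hyp_eqI: "hcomp 1 z = hcomp 1 w \<Longrightarrow> hcomp 2 z = hcomp 2 w \<Longrightarrow> z = w"
  using hyp_decomp[of z] hyp_decomp[of w] by simp

text \<open>The order of the class instance is \<open>\<preceq>\<close>, so \<open>{0..}\<close> is the cone of
  nonnegative hyperbolic numbers and \<open>{0..1}\<close> the hyperbolic unit interval.\<close>

instantiation hyp :: order
begin

definition "z \<le> w \<longleftrightarrow> hcomp 1 z \<le> hcomp 1 w \<and> hcomp 2 z \<le> hcomp 2 w"
definition less_hyp :: "hyp \<Rightarrow> hyp \<Rightarrow> bool" where "less_hyp z w \<longleftrightarrow> z \<le> w \<and> \<not> w \<le> z"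

instance
  by standard (auto simp: less_eq_hyp_def less_hyp_def intro: hyp_eqI)

end

section \<open>Hyperbolic distributions and negators\<close>

definition hsum :: "hyp ^ 'n \<Rightarrow> hyp" where
  "hsum P = (\<Sum>j\<in>UNIV. P $ j)"

definition hsum_comp :: "nat \<Rightarrow> hyp ^ 'n \<Rightarrow> real" where
  "hsum_comp l P = (\<Sum>j\<in>UNIV. hcomp l (P $ j))"

lemma hsum_comp_eq: "hsum_comp l P = hcomp l (hsum P)"
  by (simp add: hsum_comp_def hsum_def hcomp_sum)

definition hyp_dist :: "(hyp ^ 'n) set" where
  "hyp_dist = {P. (\<forall>j. P $ j \<in> {0..1}) \<and> hsum P \<in> {1, hyp_e1, hyp_e2}}"

definition active :: "nat \<Rightarrow> hyp ^ 'n \<Rightarrow> bool" where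
  "active l P \<longleftrightarrow> hsum_comp l P = 1"

definition hyp_unif :: "hyp \<Rightarrow> hyp ^ 'n" where
  "hyp_unif s = (\<chi> j. (1 / real CARD('n)) *\<^sub>R s)"

definition hyp_sep :: "hyp ^ 'n \<Rightarrow> hyp ^ 'n \<Rightarrow> real" where
  "hyp_sep P Q = sqrt (\<Sum>j\<in>UNIV.
     \<bar>(hcomp 1 (P $ j) - hcomp 1 (Q $ j)) * (hcomp 2 (P $ j) - hcomp 2 (Q $ j))\<bar>)"

definition qdev_comp :: "nat \<Rightarrow> hyp ^ 'n \<Rightarrow> real" where
  "qdev_comp l P = (\<Sum>j\<in>UNIV. (hcomp l (P $ j) - hsum_comp l P / real CARD('n))\<^sup>2)"

definition qdev :: "hyp ^ 'n \<Rightarrow> hyp" where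
  "qdev P = qdev_comp 1 P *\<^sub>R hyp_e1 + qdev_comp 2 P *\<^sub>R hyp_e2"

definition gen_norm :: "(hyp \<Rightarrow> hyp) \<Rightarrow> nat \<Rightarrow> hyp ^ 'n \<Rightarrow> real" where
  "gen_norm \<Phi> l P = (\<Sum>j\<in>UNIV. hcomp l (\<Phi> (P $ j)))"

text \<open>The type argument carries the length of the distributions, since admissibility
  depends on it. Values of \<open>\<Phi>\<close> outside \<open>{0..1}\<close> play no role.\<close>

definition admissible_generator :: "'n::finite itself \<Rightarrow> (hyp \<Rightarrow> hyp) \<Rightarrow> bool" where
  "admissible_generator _ \<Phi> \<longleftrightarrow>
     \<Phi> ` {0..1} \<subseteq> {0..} \<and>
     (\<forall>z\<in>{0..1}. \<forall>w\<in>{0..1}. z \<le> w \<longrightarrow> \<Phi> w \<le> \<Phi> z) \<and>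
     (\<forall>P \<in> (hyp_dist :: (hyp ^ 'n) set). \<forall>l\<in>{1,2}. active l P \<longrightarrow> gen_norm \<Phi> l P > 0)"

definition negator_comp :: "(hyp \<Rightarrow> hyp) \<Rightarrow> nat \<Rightarrow> hyp ^ 'n \<Rightarrow> 'n \<Rightarrow> real" where
  "negator_comp \<Phi> l P j = (if active l P then hcomp l (\<Phi> (P $ j)) / gen_norm \<Phi> l P else 0)"

definition negator :: "(hyp \<Rightarrow> hyp) \<Rightarrow> hyp ^ 'n \<Rightarrow> hyp ^ 'n" where
  "negator \<Phi> P = (\<chi> j. negator_comp \<Phi> 1 P j *\<^sub>R hyp_e1 + negator_comp \<Phi> 2 P j *\<^sub>R hyp_e2)"

lemma hsum_comp_cases:
  assumes "P \<in> hyp_dist" "l \<in> {1,2}"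
  shows "hsum_comp l P = 0 \<or> hsum_comp l P = 1"
  using assms by (auto simp: hyp_dist_def hsum_comp_eq)

lemma hcomp_negator:
  "l \<in> {1,2} \<Longrightarrow> hcomp l (negator \<Phi> P $ j) = negator_comp \<Phi> l P j"
  by (auto simp: negator_def)

lemma hsum_negator:
  fixes P :: "hyp ^ 'n::finite"
  assumes "admissible_generator TYPE('n) \<Phi>" "P \<in> hyp_dist"
  shows "hsum (negator \<Phi> P) = hsum P"
proof -
  have "hsum_comp l (negator \<Phi> P) = hsum_comp l P" if l: "l \<in> {1,2}" for l
  proof (cases "active l P")
    case True
    then have "gen_norm \<Phi> l P > 0"
      using assms l by (auto simp: admissible_generator_def)
    then have "(\<Sum>j\<in>UNIV. hcomp l (\<Phi> (P $ j)) / gen_norm \<Phi> l P) = 1"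
      by (simp add: gen_norm_def flip: sum_divide_distrib)
    then show ?thesis
      using True l
      by (simp add: hsum_comp_def[of l "negator \<Phi> P"] hcomp_negator negator_comp_def)
         (simp add: active_def)
  next
    case False
    then have "hsum_comp l P = 0"
      using hsum_comp_cases[OF assms(2) l] by (auto simp: active_def)
    then show ?thesis
      using False l
      by (simp add: hsum_comp_def[of l "negator \<Phi> P"] hcomp_negator negator_comp_def)
  qed
  from this[of 1] this[of 2] show ?thesis
    by (auto simp: hsum_comp_eq intro: hyp_eqI)
qed

lemma negator_in_hyp_dist:
  fixes P :: "hyp ^ 'n::finite"
  assumes adm: "admissible_generator TYPE('n) \<Phi>" and P: "P \<in> hyp_dist"
  shows "negator \<Phi> P \<in> hyp_dist"
proof -
  have "0 \<le> negator_comp \<Phi> l P j \<and> negator_comp \<Phi> l P j \<le> 1" if l: "l \<in> {1,2}" for l j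
  proof (cases "active l P")
    case True
    then have Z: "gen_norm \<Phi> l P > 0"
      using adm P l by (auto simp: admissible_generator_def)
    have nn: "hcomp l (\<Phi> (P $ i)) \<ge> 0" for i
    proof -
      have "P $ i \<in> {0..1}" using P by (simp add: hyp_dist_def)
      then have "\<Phi> (P $ i) \<in> {0..}" using adm unfolding admissible_generator_def by blast
      then show ?thesis using l by (auto simp: less_eq_hyp_def)
    qed
    have "hcomp l (\<Phi> (P $ j)) \<le> gen_norm \<Phi> l P"
      unfolding gen_norm_def by (rule member_le_sum) (auto simp: nn)
    then show ?thesis using Z nn[of j] True by (simp add: negator_comp_def)
  qed (simp add: negator_comp_def)
  from this[of 1] this[of 2] have "negator \<Phi> P $ j \<in> {0..1}" for j
    by (simp add: less_eq_hyp_def hcomp_negator[of 1, simplified] hcomp_negator[of 2, simplified])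
  moreover have "hsum (negator \<Phi> P) \<in> {1, hyp_e1, hyp_e2}"
    using hsum_negator[OF adm P] P by (simp add: hyp_dist_def)
  ultimately show ?thesis by (simp add: hyp_dist_def)
qed

end

theory Submission
  imports Defs
begin

text \<open>Fix an active component, and compare \<open>q\<^sub>j = \<Phi>(p\<^sub>j) / Z\<close> with the
  linear negator \<open>r\<^sub>j = (1 - p\<^sub>j) / (n - 1)\<close>, whose quadratic deviation is exactly
  \<open>(n - 1)\<^sup>-\<^sup>2\<close> times that of \<open>p\<close>. By hypothesis, \<open>q\<close> and \<open>r\<close> are both
  decreasing in \<open>p\<close> while \<open>q / r\<close> is increasing. Since \<open>q\<close> and \<open>r\<close> both sum to 1,
  \[ 2 \sum_i (r_i^2 - q_i^2) = \sum_{i,j} (r_i q_j - q_i r_j) (r_i + q_i - r_j - q_j), \]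
  and every summand on the right is nonnegative. So \<open>q\<close> deviates at most as much as \<open>r\<close>,
  and iterating gives the geometric rate. The bound on the separation is the Cauchy-Schwarz
  inequality.\<close>

text \<open>Because both totals are 1, summing \<open>?T i j\<close> over \<open>j\<close> leaves
  \<open>(r i)\<^sup>2 - (q i)\<^sup>2\<close>.\<close>

lemma sum_squares_le_if_cross_nonneg:
  fixes q r :: "'a \<Rightarrow> real"
  assumes sums: "sum q A = 1" "sum r A = 1"
    and cross: "\<And>i j. i \<in> A \<Longrightarrow> j \<in> A \<Longrightarrow> 0 \<le> (r i * q j - q i * r j) * (r i + q i - r j - q j)"
  shows "(\<Sum>i\<in>A. (q i)\<^sup>2) \<le> (\<Sum>i\<in>A. (r i)\<^sup>2)"
proof -
  let ?T = "\<lambda>i j. (r i * q j - q i * r j) * (r i + q i)"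
  have row: "(\<Sum>j\<in>A. ?T i j) = (r i)\<^sup>2 - (q i)\<^sup>2" for i
  proof -
    have "(\<Sum>j\<in>A. ?T i j) = (r i * sum q A - q i * sum r A) * (r i + q i)"
      by (simp add: sum_subtractf flip: sum_distrib_left sum_distrib_right)
    then show ?thesis
      by (simp add: sums power2_eq_square algebra_simps)
  qed
  have "0 \<le> (\<Sum>i\<in>A. \<Sum>j\<in>A. (r i * q j - q i * r j) * (r i + q i - r j - q j))"
    by (intro sum_nonneg cross)
  \<comment> \<open>The factor \<open>r i * q j - q i * r j\<close> changes sign when
    \<open>i\<close> and \<open>j\<close> are exchanged, so its product with
    \<open>- (r j + q j)\<close> is \<open>?T j i\<close>.\<close>
  also have "\<dots> = (\<Sum>i\<in>A. \<Sum>j\<in>A. ?T i j + ?T j i)"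
    by (intro sum.cong refl) (simp add: algebra_simps)
  also have "\<dots> = (\<Sum>i\<in>A. \<Sum>j\<in>A. ?T i j) + (\<Sum>i\<in>A. \<Sum>j\<in>A. ?T j i)"
    by (simp add: sum.distrib)
  also have "(\<Sum>i\<in>A. \<Sum>j\<in>A. ?T j i) = (\<Sum>i\<in>A. \<Sum>j\<in>A. ?T i j)"
    by (rule sum.swap)
  finally show ?thesis
    by (simp add: row sum_subtractf)
qed

text \<open>For families of total 1, this reduces comparing deviations from the mean to comparing
  sums of squares.\<close>

lemma sum_square_deviation:
  fixes x :: "'a::finite \<Rightarrow> real"
  assumes "(\<Sum>i\<in>UNIV. x i) = 1"
  shows "(\<Sum>i\<in>UNIV. (x i - 1 / real CARD('a))\<^sup>2) = (\<Sum>i\<in>UNIV. (x i)\<^sup>2) - 1 / real CARD('a)"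
proof -
  let ?n = "real CARD('a)"
  have "(\<Sum>i\<in>UNIV. (x i - 1 / ?n)\<^sup>2) = (\<Sum>i\<in>UNIV. (x i)\<^sup>2 - (2 / ?n) * x i + (1 / ?n)\<^sup>2)"
    by (intro sum.cong refl) (simp add: power2_diff)
  also have "\<dots> = (\<Sum>i\<in>UNIV. (x i)\<^sup>2) - (2 / ?n) * (\<Sum>i\<in>UNIV. x i) + ?n * (1 / ?n)\<^sup>2"
    by (simp only: sum.distrib sum_subtractf sum_distrib_left sum_constant)
  finally show ?thesis
    by (simp add: assms power2_eq_square field_simps)
qed

text \<open>One contraction step in one active component. Here \<open>f\<close> is indexed by
  positions and is not a function of \<open>p i\<close>, since a component of \<open>\<Phi>\<close>
  may depend on both components of its argument.\<close>

lemma linear_negator_comparison: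
  fixes p f :: "'a::finite \<Rightarrow> real"
  assumes card: "CARD('a) > 1"
    and p: "\<And>i. p i \<le> 1" "(\<Sum>i\<in>UNIV. p i) = 1"
    and Z: "(\<Sum>i\<in>UNIV. f i) > 0"
    and f: "\<And>i. f i \<ge> 0" "\<And>i. p i = 1 \<Longrightarrow> f i = 0"
    and antimono: "\<And>i j. p i \<le> p j \<Longrightarrow> p j < 1 \<Longrightarrow> f j \<le> f i"
    and ratio: "\<And>i j. p i \<le> p j \<Longrightarrow> p j < 1 \<Longrightarrow> f i / (1 - p i) \<le> f j / (1 - p j)"
  shows "(\<Sum>i\<in>UNIV. (f i / (\<Sum>i\<in>UNIV. f i) - 1 / real CARD('a))\<^sup>2)
    \<le> (\<Sum>i\<in>UNIV. (p i - 1 / real CARD('a))\<^sup>2) / (real CARD('a) - 1)\<^sup>2"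
proof -
  define n where "n = real CARD('a)"
  define Z' where "Z' = (\<Sum>i\<in>UNIV. f i)"
  define q where "q i = f i / Z'" for i
  define r where "r i = (1 - p i) / (n - 1)" for i
  have n: "n > 1" using card by (simp add: n_def)
  have Z': "Z' > 0" using Z by (simp add: Z'_def)
  have sq: "(\<Sum>i\<in>UNIV. q i) = 1"
    using Z' by (simp add: q_def Z'_def flip: sum_divide_distrib)
  have sr: "(\<Sum>i\<in>UNIV. r i) = 1"
    using n by (simp add: r_def sum_subtractf p n_def flip: sum_divide_distrib)
  \<comment> \<open>The monotonicity of \<open>q / r\<close> is stated as a product, which stays
    meaningful when \<open>p j = 1\<close> and hence \<open>r j = 0\<close>. In that case
    \<open>q j = 0\<close> too, and only nonnegativity remains to be checked.\<close>
  have ordered: "r j \<le> r i \<and> q j \<le> q i \<and> q i * r j \<le> r i * q j" if le: "p i \<le> p j" for i j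
  proof (cases "p j = 1")
    case True
    then show ?thesis
      using f(2)[OF True] f(1)[of i] p(1)[of i] n Z' by (simp add: q_def r_def)
  next
    case False
    with p(1)[of j] have less: "p j < 1" by simp
    have "f i * (1 - p j) \<le> (1 - p i) * f j"
      using ratio[OF le less] le less by (simp add: field_simps)
    then have "q i * r j \<le> r i * q j"
      using n Z' by (simp add: q_def r_def divide_simps mult_ac)
    moreover have "q j \<le> q i"
      using antimono[OF le less] Z' by (simp add: q_def divide_right_mono)
    moreover have "r j \<le> r i"
      using le n by (simp add: r_def divide_right_mono)
    ultimately show ?thesis by simp
  qed
  have "(\<Sum>i\<in>UNIV. (q i)\<^sup>2) \<le> (\<Sum>i\<in>UNIV. (r i)\<^sup>2)"
  proof (rule sum_squares_le_if_cross_nonneg[OF sq sr])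
    fix i j
    show "0 \<le> (r i * q j - q i * r j) * (r i + q i - r j - q j)"
    \<comment> \<open>Both factors are nonnegative in the first case and nonpositive in the
      second.\<close>
    proof (cases "p i \<le> p j")
      case True
      from ordered[OF this] show ?thesis by (intro mult_nonneg_nonneg) auto
    next
      case False
      then have "p j \<le> p i" by simp
      from ordered[OF this] show ?thesis by (intro mult_nonpos_nonpos) (auto simp: mult_ac)
    qed
  qed
  then have "(\<Sum>i\<in>UNIV. (q i - 1 / n)\<^sup>2) \<le> (\<Sum>i\<in>UNIV. (r i - 1 / n)\<^sup>2)"
    using sum_square_deviation[OF sq] sum_square_deviation[OF sr] by (simp add: n_def)
  also have "\<dots> = (\<Sum>i\<in>UNIV. (p i - 1 / n)\<^sup>2 / (n - 1)\<^sup>2)"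
  proof (intro sum.cong refl)
    fix i
    \<comment> \<open>The linear negator reflects each deviation about \<open>1 / n\<close> and
      divides it by \<open>n - 1\<close>; this is where the rate comes from.\<close>
    have "r i - 1 / n = - ((p i - 1 / n) / (n - 1))"
      using n by (simp add: r_def field_simps)
    then show "(r i - 1 / n)\<^sup>2 = (p i - 1 / n)\<^sup>2 / (n - 1)\<^sup>2"
      by (simp add: power_divide)
  qed
  finally show ?thesis
    by (simp add: q_def Z'_def n_def sum_divide_distrib)
qed

lemma qdev_comp_nonneg: "qdev_comp l P \<ge> 0"
  by (simp add: qdev_comp_def sum_nonneg)

lemma qdev_comp_member:
  fixes P :: "hyp ^ 'n::finite"
  shows "(hcomp l (P $ j) - hsum_comp l P / real CARD('n))\<^sup>2 \<le> qdev_comp l P"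
  unfolding qdev_comp_def by (rule member_le_sum) auto

lemma hcomp_mem_unit_interval:
  assumes "P \<in> hyp_dist" "l \<in> {1,2}"
  shows "hcomp l (P $ j) \<in> {0..1}"
proof -
  have "P $ j \<in> {0..1}" using assms(1) by (simp add: hyp_dist_def)
  then show ?thesis using assms(2) by (auto simp: less_eq_hyp_def)
qed

lemma hsum_comp_negator:
  fixes P :: "hyp ^ 'n::finite"
  assumes "admissible_generator TYPE('n) \<Phi>" "P \<in> hyp_dist"
  shows "hsum_comp l (negator \<Phi> P) = hsum_comp l P"
  using hsum_negator[OF assms] by (simp add: hsum_comp_eq)

lemma negator_iterate_in_hyp_dist:
  fixes P :: "hyp ^ 'n::finite"
  assumes "admissible_generator TYPE('n) \<Phi>" "P \<in> hyp_dist"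
  shows "(negator \<Phi> ^^ m) P \<in> hyp_dist"
  by (induction m) (simp_all add: assms negator_in_hyp_dist)

text \<open>All iterates share the centre of their deviations, so bounds on them can refer to the
  total of \<open>P\<close>.\<close>

lemma hsum_comp_negator_iterate:
  fixes P :: "hyp ^ 'n::finite"
  assumes "admissible_generator TYPE('n) \<Phi>" "P \<in> hyp_dist"
  shows "hsum_comp l ((negator \<Phi> ^^ m) P) = hsum_comp l P"
  by (induction m)
    (simp_all add: hsum_comp_negator[OF assms(1)] negator_iterate_in_hyp_dist[OF assms])

lemma qdev_comp_negator_le:
  fixes P :: "hyp ^ 'n::finite"
  assumes card: "CARD('n) > 1"
    and adm: "admissible_generator TYPE('n) \<Phi>" and P: "P \<in> hyp_dist" and l: "l \<in> {1,2}"
    and zero: "\<And>j. active l P \<Longrightarrow> hcomp l (P $ j) = 1 \<Longrightarrow> hcomp l (\<Phi> (P $ j)) = 0"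
    and ratio: "\<And>i j. \<lbrakk>active l P; hcomp l (P $ i) \<le> hcomp l (P $ j); hcomp l (P $ j) < 1\<rbrakk>
        \<Longrightarrow> hcomp l (\<Phi> (P $ i)) \<ge> hcomp l (\<Phi> (P $ j)) \<and>
            hcomp l (\<Phi> (P $ i)) / (1 - hcomp l (P $ i)) \<le> hcomp l (\<Phi> (P $ j)) / (1 - hcomp l (P $ j))"
  shows "qdev_comp l (negator \<Phi> P) \<le> qdev_comp l P / (real CARD('n) - 1)\<^sup>2"
proof (cases "active l P")
  case True
  have sum1: "hsum_comp l P = 1" using True by (simp add: active_def)
  have Z: "gen_norm \<Phi> l P > 0"
    using adm P l True by (auto simp: admissible_generator_def)
  have nonneg: "hcomp l (\<Phi> (P $ i)) \<ge> 0" for i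
  proof -
    have "P $ i \<in> {0..1}" using P by (simp add: hyp_dist_def)
    then have "\<Phi> (P $ i) \<in> {0..}" using adm unfolding admissible_generator_def by blast
    then show ?thesis using l by (auto simp: less_eq_hyp_def)
  qed
  have "(\<Sum>i\<in>UNIV. (hcomp l (\<Phi> (P $ i)) / (\<Sum>i\<in>UNIV. hcomp l (\<Phi> (P $ i))) - 1 / real CARD('n))\<^sup>2)
    \<le> (\<Sum>i\<in>UNIV. (hcomp l (P $ i) - 1 / real CARD('n))\<^sup>2) / (real CARD('n) - 1)\<^sup>2"
  proof (rule linear_negator_comparison[OF card])
    show "hcomp l (P $ i) \<le> 1" for i using hcomp_mem_unit_interval[OF P l] by simp
    show "(\<Sum>i\<in>UNIV. hcomp l (P $ i)) = 1" using sum1 by (simp add: hsum_comp_def)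
    show "0 < (\<Sum>i\<in>UNIV. hcomp l (\<Phi> (P $ i)))" using Z by (simp add: gen_norm_def)
  qed (use nonneg zero ratio True in blast)+
  then show ?thesis
    using True
    by (simp add: qdev_comp_def hsum_comp_negator[OF adm P] sum1 hcomp_negator[OF l]
      negator_comp_def gen_norm_def)
next
  \<comment> \<open>An inactive component is sent to zero and has total zero, so its deviation
    vanishes.\<close>
  case False
  then have "hsum_comp l P = 0"
    using hsum_comp_cases[OF P l] by (auto simp: active_def)
  then have "qdev_comp l (negator \<Phi> P) = 0"
    using False
    by (simp add: qdev_comp_def hsum_comp_negator[OF adm P] hcomp_negator[OF l] negator_comp_def)
  then show ?thesis by (simp add: qdev_comp_nonneg)
qed

text \<open>Cauchy-Schwarz applied to the deviation vectors of the two components, whose Euclidean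
  norms are the square roots of \<open>qdev_comp 1 P\<close> and
  \<open>qdev_comp 2 P\<close>.\<close>

lemma hyp_sep_unif_square_le:
  fixes P :: "hyp ^ 'n::finite"
  shows "(hyp_sep P (hyp_unif (hsum P)))\<^sup>2 \<le> sqrt (qdev_comp 1 P * qdev_comp 2 P)"
proof -
  define x where "x l j = hcomp l (P $ j) - hsum_comp l P / real CARD('n)" for l j
  have "(hyp_sep P (hyp_unif (hsum P)))\<^sup>2 = (\<Sum>j\<in>UNIV. \<bar>x 1 j\<bar> * \<bar>x 2 j\<bar>)"
    by (simp add: hyp_sep_def hyp_unif_def x_def hsum_comp_eq sum_nonneg abs_mult)
  also have "\<dots> \<le> L2_set (x 1) UNIV * L2_set (x 2) UNIV"
    by (rule L2_set_mult_ineq)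
  also have "\<dots> = sqrt (qdev_comp 1 P * qdev_comp 2 P)"
    by (simp add: L2_set_def qdev_comp_def x_def real_sqrt_mult)
  finally show ?thesis .
qed

theorem proposition5p5:
  fixes \<Phi> :: "hyp \<Rightarrow> hyp"
  assumes n: "CARD('n::finite) > 2"
    and adm: "admissible_generator TYPE('n) \<Phi>"
    and zero: "\<And>(P :: hyp ^ 'n) l j. \<lbrakk>P \<in> hyp_dist; l \<in> {1,2}; active l P; hcomp l (P $ j) = 1\<rbrakk>
        \<Longrightarrow> hcomp l (\<Phi> (P $ j)) = 0"
    and ratio: "\<And>(P :: hyp ^ 'n) l i j. \<lbrakk>P \<in> hyp_dist; l \<in> {1,2}; active l P;
          hcomp l (P $ i) \<le> hcomp l (P $ j); hcomp l (P $ j) < 1\<rbrakk>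
        \<Longrightarrow> hcomp l (\<Phi> (P $ i)) \<ge> hcomp l (\<Phi> (P $ j)) \<and>
            hcomp l (\<Phi> (P $ i)) / (1 - hcomp l (P $ i)) \<le> hcomp l (\<Phi> (P $ j)) / (1 - hcomp l (P $ j))"
  shows "\<forall>P \<in> (hyp_dist :: (hyp ^ 'n) set). \<forall>m::nat.
      (let P\<^sub>m = (negator \<Phi> ^^ m) P; c = 1 / (real CARD('n) - 1) ^ (2 * m) in
        qdev P\<^sub>m \<le> c *\<^sub>R qdev P \<and>
        (\<forall>j. \<forall>l\<in>{1,2}. (hcomp l (P\<^sub>m $ j) - hsum_comp l P / real CARD('n))\<^sup>2 \<le> c * qdev_comp l P) \<and>
        (hyp_sep P\<^sub>m (hyp_unif (hsum P)))\<^sup>2 \<le> c * sqrt (qdev_comp 1 P * qdev_comp 2 P))"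
proof (intro ballI allI)
  fix P :: "hyp ^ 'n" and m :: nat
  assume P: "P \<in> hyp_dist"
  let ?d = "real CARD('n) - 1"
  define Pm where "Pm = (negator \<Phi> ^^ m) P"
  define c where "c = 1 / ?d ^ (2 * m)"
  have c: "c \<ge> 0" using n by (simp add: c_def)
  have Q: "qdev_comp l Pm \<le> c * qdev_comp l P" if l: "l \<in> {1,2}" for l
    unfolding Pm_def c_def
  proof (induction m)
    case (Suc m)
    let ?R = "(negator \<Phi> ^^ m) P"
    have R: "?R \<in> hyp_dist" by (rule negator_iterate_in_hyp_dist[OF adm P])
    \<comment> \<open>The hypotheses on \<open>\<Phi>\<close> range over all distributions, so they
      apply to the iterate \<open>?R\<close> itself.\<close>
    have "qdev_comp l (negator \<Phi> ?R) \<le> qdev_comp l ?R / ?d\<^sup>2"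
      using n by (intro qdev_comp_negator_le adm R l zero[OF R l] ratio[OF R l]) auto
    also have "\<dots> \<le> (1 / ?d ^ (2 * m) * qdev_comp l P) / ?d\<^sup>2"
      by (intro divide_right_mono Suc.IH) simp
    also have "\<dots> = 1 / ?d ^ (2 * Suc m) * qdev_comp l P"
      by (simp add: power2_eq_square)
    finally show ?case by simp
  qed simp
  have hs: "hsum_comp l Pm = hsum_comp l P" for l
    unfolding Pm_def by (rule hsum_comp_negator_iterate[OF adm P])
  have "hsum Pm = hsum P"
    using hs[of 1] hs[of 2] by (auto simp: hsum_comp_eq intro: hyp_eqI)
  then have "(hyp_sep Pm (hyp_unif (hsum P)))\<^sup>2 \<le> sqrt (qdev_comp 1 Pm * qdev_comp 2 Pm)"
    using hyp_sep_unif_square_le[of Pm] by simp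
  also have "\<dots> \<le> sqrt ((c * qdev_comp 1 P) * (c * qdev_comp 2 P))"
    using Q[of 1] Q[of 2] c by (intro real_sqrt_le_mono mult_mono) (auto simp: qdev_comp_nonneg)
  also have "\<dots> = c * sqrt (qdev_comp 1 P * qdev_comp 2 P)"
    using c by (simp add: real_sqrt_mult)
  finally have "(hyp_sep Pm (hyp_unif (hsum P)))\<^sup>2 \<le> c * sqrt (qdev_comp 1 P * qdev_comp 2 P)" .
  moreover have "qdev Pm \<le> c *\<^sub>R qdev P"
    using Q[of 1] Q[of 2] by (simp add: less_eq_hyp_def qdev_def)
  moreover have "(hcomp l (Pm $ j) - hsum_comp l P / real CARD('n))\<^sup>2 \<le> c * qdev_comp l P"
    if "l \<in> {1,2}" for j l
    using order_trans[OF qdev_comp_member Q[OF that]] by (simp add: hs)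
  ultimately show "let P\<^sub>m = (negator \<Phi> ^^ m) P; c = 1 / ?d ^ (2 * m) in
        qdev P\<^sub>m \<le> c *\<^sub>R qdev P \<and>
        (\<forall>j. \<forall>l\<in>{1,2}. (hcomp l (P\<^sub>m $ j) - hsum_comp l P / real CARD('n))\<^sup>2 \<le> c * qdev_comp l P) \<and>
        (hyp_sep P\<^sub>m (hyp_unif (hsum P)))\<^sup>2 \<le> c * sqrt (qdev_comp 1 P * qdev_comp 2 P)"
    unfolding Let_def Pm_def c_def by blast
qed

end
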